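(* Let $f$ be a $K$-neighborhood exposure mapping, let $t,t'$ be exposure values, and suppose the overlap condition holds: for every $i\in\mathcal{N}_n$, every $c$ in the support of $\mathcal{C}_i$ and every $s\in\{t,t'\}$, the conditional distribution of $\bm{D}$ given $T_i=s,\ \mathcal{C}_i=c$ exists. Assume: (1) (Unconfoundedness) for all $i\in\mathcal{N}_n$, $Y_i(\cdot)$ is independent of $\bm{D}$ conditional on $\mathcal{C}_i$; (2) ($t'$-degeneracy) for every $i\in\mathcal{N}_n$ there exists $\bm{\delta}_i\in\{0,1\}^{|\mathcal{N}(i,K)|}$ such that, for any $\bm{d}\in\{0,1\}^n$, $f(\bm{d}_{\mathcal{N}(i,K)})=t'$ implies $Y_i(\bm{d})=Y_i(\bm{\delta}_i,\bm{d}_{-\mathcal{N}(i,K)})$ almost surely. Then $\tau(t,t')=\tau^*(t,t')+\mathcal{B}$, where $$\tau^*(t,t')=\frac1n\sum_{i=1}^n\mathbf{E}\big[Y_i(\bm{D})-Y_i(\bm{\delta}_i,\bm{D}_{-\mathcal{N}(i,K)})\mid T_i=t,\mathcal{C}_i\big]$$ and $$\mathcal{B}=\frac1n\sum_{i=1}^n\Big(\mathbf{E}\big[Y_i(\bm{\delta}_i,\bm{D}_{-\mathcal{N}(i,K)})\mid T_i=t,\mathcal{C}_i\big]-\mathbf{E}\big[Y_i(\bm{\delta}_i,\bm{D}_{-\mathcal{N}(i,K)})\mid T_i=t',\mathcal{C}_i\big]\Big).$$ If, in addition, for every $i\in\mathcal{N}_n$, $\bm{D}_{\mathcal{N}(i,K)}$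 is independent of $\bm{D}_{-\mathcal{N}(i,K)}$ conditional on $\mathcal{C}_i$, then $\mathcal{B}=0$.
   Context: There are $n$ units, $\mathcal{N}_n=\{1,\dots,n\}$. $\bm{D}=(D_i)_{i=1}^n\in\{0,1\}^n$ is the random treatment assignment vector. For each $i$, $Y_i(\cdot)$ is a (possibly random) map $\{0,1\}^n\to\mathbb{R}$ of potential outcomes, and the observed outcome is $Y_i=Y_i(\bm{D})$. $\mathcal{C}_i$ is a random array of control variables for unit $i$. Units are connected through a network $\bm{A}$, an $n\times n$ binary matrix, treated as non-random (or conditioned upon). For an integer $K\ge0$, $\mathcal{N}(i,K)$ is the set of units at path distance at most $K$ from $i$ in $\bm{A}$ (path distance is the length of a shortest path, $\infty$ if there is none, and $0$ from a unit to itself, so $\mathcal{N}(i,0)=\{i\}$). For $\bm{d}\in\{0,1\}^n$, $\bm{d}_{\mathcal{N}(i,K)}=(d_j:j\in\mathcal{N}(i,K))$ and $\bm{d}_{-\mathcal{N}(i,K)}=(d_j:j\in\mathcal{N}_n\setminus\mathcal{N}(i,K))$, and $Y_i(\bm{d}_{\mathcal{N}(i,K)},\bm{d}_{-\mathcal{N}(i,K)})$ means $Y_i(\bm{d})$. An exposure mapping is a deterministic function $f:\mathcal{N}_n\times\{0,1\}^n\to\mathbb{R}^{d_t}$, with $T_i=f(i,\bm{D})$; it is a $K$-neighborhood exposure mapping if $f(i,\bm{d})=f(i,\bm{d}')$ for all $i$ and all $\bm{d},\bm{d}'$ with $\bm{d}_{\mathcal{N}(i,K)}=\bm{d}'_{\mathcal{N}(i,K)}$,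 in which case one writes $f(\bm{d}_{\mathcal{N}(i,K)})$ for $f(i,\bm{d})$. The exposure contrast is $$\tau(t,t')=\frac1n\sum_{i=1}^n\big(\mathbf{E}[Y_i\mid T_i=t,\mathcal{C}_i]-\mathbf{E}[Y_i\mid T_i=t',\mathcal{C}_i]\big),$$ where $\mathbf{E}[Y_i\mid T_i=t,\mathcal{C}_i]$ means $m_t(\mathcal{C}_i)$ with $m_t(c)=\mathbf{E}[Y_i\mid T_i=t,\mathcal{C}_i=c]$. All expectations are assumed to exist and be finite. *)

theory Defs
  imports "HOL-Probability.Probability" "HOL-Library.Extended_Nat"
begin

section \<open>Neighborhoods and exposure mappings\<close>

definition is_path :: "bool ^ 'n ^ 'n \<Rightarrow> 'n \<Rightarrow> 'n \<Rightarrow> 'n list \<Rightarrow> bool" where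
  "is_path A i j p \<longleftrightarrow> p \<noteq> [] \<and> hd p = i \<and> last p = j \<and> distinct p \<and>
     successively (\<lambda>u v. A $ u $ v) p"

text \<open>The infimum of the empty set in \<^typ>\<open>enat\<close> is \<open>\<infinity>\<close>.\<close>

definition path_dist :: "bool ^ 'n ^ 'n \<Rightarrow> 'n \<Rightarrow> 'n \<Rightarrow> enat" where
  "path_dist A i j = (INF p\<in>{p. is_path A i j p}. enat (length p - 1))"

definition nbhd :: "bool ^ 'n ^ 'n \<Rightarrow> 'n \<Rightarrow> nat \<Rightarrow> 'n set" where
  "nbhd A i K = {j. path_dist A i j \<le> enat K}"

lemma nbhd_0: "nbhd A i 0 = {i}"
proof -
  have "path_dist A i j = 0 \<longleftrightarrow> j = i" for j
  proof
    assume "path_dist A i j = 0"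
    then have "(INF p\<in>{p. is_path A i j p}. enat (length p - 1)) < 1"
      by (simp add: path_dist_def)
    then obtain p where p: "is_path A i j p" "enat (length p - 1) < 1"
      by (auto simp: Inf_less_iff)
    then have "length p \<le> 1" by (simp add: one_enat_def)
    with p(1) have "length p = 1" by (cases p) (auto simp: is_path_def)
    then obtain x where "p = [x]" by (auto simp: length_Suc_conv)
    with p(1) show "j = i" by (auto simp: is_path_def)
  next
    assume "j = i"
    then have "is_path A i j [i]" by (simp add: is_path_def)
    then have "path_dist A i j \<le> enat (length [i] - 1)"
      unfolding path_dist_def by (intro INF_lower) simp
    then show "path_dist A i j = 0" by (simp add: zero_enat_def[symmetric])
  qed
  then show ?thesis by (auto simp: nbhd_def zero_enat_def[symmetric])
qed

definition nbhd_exposure_mapping ::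
    "bool ^ 'n ^ 'n \<Rightarrow> nat \<Rightarrow> ('n \<Rightarrow> ('n \<Rightarrow> bool) \<Rightarrow> 'e) \<Rightarrow> bool" where
  "nbhd_exposure_mapping A K f \<longleftrightarrow>
     (\<forall>i d d'. (\<forall>j\<in>nbhd A i K. d j = d' j) \<longrightarrow> f i d = f i d')"


section \<open>Conditioning\<close>

definition gen_sigma :: "'w measure \<Rightarrow> 'a measure \<Rightarrow> ('w \<Rightarrow> 'a) \<Rightarrow> 'w measure" where
  "gen_sigma M S X = vimage_algebra (space M) X S"

definition cprob :: "'w measure \<Rightarrow> 'c measure \<Rightarrow> ('w \<Rightarrow> 'c) \<Rightarrow> ('w \<Rightarrow> bool) \<Rightarrow> 'w \<Rightarrow> real" where
  "cprob M E C P = real_cond_exp M (gen_sigma M E C) (indicator {\<omega> \<in> space M. P \<omega>})"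

definition cond_indep :: "'w measure \<Rightarrow> 'a measure \<Rightarrow> ('w \<Rightarrow> 'a) \<Rightarrow> 'b measure \<Rightarrow> ('w \<Rightarrow> 'b) \<Rightarrow>
    'c measure \<Rightarrow> ('w \<Rightarrow> 'c) \<Rightarrow> bool" where
  "cond_indep M S X R Z E C \<longleftrightarrow>
     X \<in> measurable M S \<and> Z \<in> measurable M R \<and> C \<in> measurable M E \<and>
     (\<forall>a\<in>sets S. \<forall>b\<in>sets R. AE \<omega> in M.
        cprob M E C (\<lambda>\<omega>. X \<omega> \<in> a \<and> Z \<omega> \<in> b) \<omega> =
        cprob M E C (\<lambda>\<omega>. X \<omega> \<in> a) \<omega> * cprob M E C (\<lambda>\<omega>. Z \<omega> \<in> b) \<omega>)"

text \<open>\<open>m\<close> is a version of the regression function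
  \<open>(s, c) \<mapsto> E[Z | T = s, C = c]\<close>.\<close>

definition is_regression :: "'w measure \<Rightarrow> ('w \<Rightarrow> real) \<Rightarrow> ('w \<Rightarrow> 'e::topological_space) \<Rightarrow>
    'c measure \<Rightarrow> ('w \<Rightarrow> 'c) \<Rightarrow> ('e \<times> 'c \<Rightarrow> real) \<Rightarrow> bool" where
  "is_regression M Z T E C m \<longleftrightarrow>
     m \<in> borel_measurable (borel \<Otimes>\<^sub>M E) \<and>
     (AE \<omega> in M. real_cond_exp M (gen_sigma M (borel \<Otimes>\<^sub>M E) (\<lambda>\<omega>. (T \<omega>, C \<omega>))) Z \<omega> =
                 m (T \<omega>, C \<omega>))"

text \<open>\<open>cmean M Z T E C s \<omega>\<close> is \<open>E[Z | T = s, C]\<close> at \<open>\<omega>\<close>, that is,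
  \<open>E[Z | T = s, C = c]\<close> at \<open>c = C(\<omega>)\<close>. It is defined for all \<open>\<omega>\<close>, not only for those with
  \<open>T(\<omega>) = s\<close>. A version exists by \<open>is_regression_exists\<close> below; under \<open>overlap\<close> the choice
  of version only matters on a null set, by \<open>is_regression_unique\<close>.\<close>

definition cmean :: "'w measure \<Rightarrow> ('w \<Rightarrow> real) \<Rightarrow> ('w \<Rightarrow> 'e::topological_space) \<Rightarrow>
    'c measure \<Rightarrow> ('w \<Rightarrow> 'c) \<Rightarrow> 'e \<Rightarrow> 'w \<Rightarrow> real" where
  "cmean M Z T E C s \<omega> = (SOME m. is_regression M Z T E C m) (s, C \<omega>)"

text \<open>For a random vector \<open>D\<close> with finitely many values and a function \<open>T\<close> of \<open>D\<close>, the
  conditional distribution of \<open>D\<close> given \<open>T = s\<close>, \<open>C = c\<close> has mass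
  \<open>P(D = d, T = s | C = c) / P(T = s | C = c)\<close> at \<open>d\<close>. It exists iff the denominator
  is positive, for almost every \<open>c\<close> under the law of \<open>C\<close> (conditional probabilities are only
  determined up to null sets).\<close>

definition overlap :: "'w measure \<Rightarrow> ('w \<Rightarrow> 'e) \<Rightarrow> 'c measure \<Rightarrow> ('w \<Rightarrow> 'c) \<Rightarrow> 'e \<Rightarrow> bool" where
  "overlap M T E C s \<longleftrightarrow> (AE \<omega> in M. cprob M E C (\<lambda>\<omega>. T \<omega> = s) \<omega> > 0)"

lemma factor_through_nonneg:
  fixes u :: "'w \<Rightarrow> real"
  assumes X: "X \<in> \<Omega> \<rightarrow> space S"
    and u: "u \<in> borel_measurable (vimage_algebra \<Omega> X S)" "\<And>x. 0 \<le> u x"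
  shows "\<exists>h\<in>borel_measurable S. \<forall>x\<in>\<Omega>. u x = h (X x)"
  using u
proof (induction rule: borel_measurable_induct_real)
  case (set A)
  then obtain B where B: "B \<in> sets S" "A = X -` B \<inter> \<Omega>"
    by (auto simp: sets_vimage_algebra2[OF X])
  then show ?case
    by (intro bexI[of _ "indicator B"]) (auto simp: indicator_def)
next
  case (mult u c)
  then obtain h where "h \<in> borel_measurable S" "\<forall>x\<in>\<Omega>. u x = h (X x)" by blast
  then show ?case by (intro bexI[of _ "\<lambda>y. c * h y"]) auto
next
  case (add u v)
  then obtain h k where "h \<in> borel_measurable S" "\<forall>x\<in>\<Omega>. u x = h (X x)"
    "k \<in> borel_measurable S" "\<forall>x\<in>\<Omega>. v x = k (X x)" by blast
  then show ?case by (intro bexI[of _ "\<lambda>y. k y + h y"]) auto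
next
  case (seq U)
  then have "\<forall>i. \<exists>h. h \<in> borel_measurable S \<and> (\<forall>x\<in>\<Omega>. U i x = h (X x))" by blast
  then obtain h where h: "\<And>i. h i \<in> borel_measurable S" "\<And>i x. x \<in> \<Omega> \<Longrightarrow> U i x = h i (X x)"
    by metis
  have "u x = lim (\<lambda>i. h i (X x))" if "x \<in> \<Omega>" for x
    using seq.hyps(4)[of x] that h(2) by (simp add: limI)
  moreover have "(\<lambda>y. lim (\<lambda>i. h i y)) \<in> borel_measurable S"
    using h(1) by (rule borel_measurable_lim_metric)
  ultimately show ?case by (intro bexI[of _ "\<lambda>y. lim (\<lambda>i. h i y)"]) auto
qed

lemma is_regression_exists:
  assumes "T \<in> borel_measurable M" "C \<in> measurable M E"
  shows "\<exists>m. is_regression M Z T E C m"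
proof -
  let ?S = "borel \<Otimes>\<^sub>M E" and ?X = "\<lambda>\<omega>. (T \<omega>, C \<omega>)"
  let ?r = "real_cond_exp M (gen_sigma M ?S ?X) Z"
  have X: "?X \<in> space M \<rightarrow> space ?S"
    using assms by (auto simp: space_pair_measure dest: measurable_space)
  have [measurable]: "?r \<in> borel_measurable (vimage_algebra (space M) ?X ?S)"
    by (metis borel_measurable_cond_exp gen_sigma_def)
  obtain h where h: "h \<in> borel_measurable ?S" "\<forall>x\<in>space M. max 0 (?r x) = h (?X x)"
    using factor_through_nonneg[OF X, of "\<lambda>x. max 0 (?r x)"] by auto
  obtain k where k: "k \<in> borel_measurable ?S" "\<forall>x\<in>space M. max 0 (- ?r x) = k (?X x)"
    using factor_through_nonneg[OF X, of "\<lambda>x. max 0 (- ?r x)"] by auto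
  have "?r x = h (?X x) - k (?X x)" if "x \<in> space M" for x
    using h(2)[rule_format, OF that] k(2)[rule_format, OF that] by linarith
  then have "is_regression M Z T E C (\<lambda>y. h y - k y)"
    using h(1) k(1) by (auto simp: is_regression_def)
  then show ?thesis by blast
qed

lemma is_regression_unique:
  assumes "prob_space M" "T \<in> borel_measurable M" "C \<in> measurable M E"
    and "overlap M T E C (s :: 'e::t1_space)"
    and "is_regression M Z T E C m" "is_regression M Z T E C m'"
  shows "AE \<omega> in M. m (s, C \<omega>) = m' (s, C \<omega>)"
proof -
  interpret prob_space M by fact
  note [measurable] = assms(2,3)
  have [measurable]: "m \<in> borel_measurable (borel \<Otimes>\<^sub>M E)" "m' \<in> borel_measurable (borel \<Otimes>\<^sub>M E)"
    using assms(5,6) by (auto simp: is_regression_def)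
  let ?F = "gen_sigma M E C"
  let ?p = "cprob M E C (\<lambda>\<omega>. T \<omega> = s)"
  let ?g = "\<lambda>\<omega>. indicator {c \<in> space E. m (s, c) \<noteq> m' (s, c)} (C \<omega>) :: real"
  let ?t = "indicator {\<omega> \<in> space M. T \<omega> = s} :: _ \<Rightarrow> real"
  have "subalgebra M ?F"
    unfolding gen_sigma_def subalgebra_def
    using measurable_space[OF assms(3)] measurable_sets[OF assms(3)]
    by (auto simp: sets_vimage_algebra2[of C "space M" E])
  then interpret finite_measure_subalgebra M ?F by unfold_locales
  have [measurable]: "C \<in> measurable ?F E"
    unfolding gen_sigma_def using measurable_space[OF assms(3)]
    by (intro measurable_vimage_algebra1) auto
  have s: "(\<lambda>c. (s, c)) \<in> measurable E (borel \<Otimes>\<^sub>M E)" by simp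
  have [measurable]: "(\<lambda>c. m (s, c)) \<in> borel_measurable E" "(\<lambda>c. m' (s, c)) \<in> borel_measurable E"
    using s by measurable
  have [measurable]: "?g \<in> borel_measurable ?F" by measurable
  have [measurable]: "?g \<in> borel_measurable M" by measurable
  have "{s} \<in> sets borel" by simp
  then have [measurable]: "{\<omega> \<in> space M. T \<omega> = s} \<in> sets M"
    using measurable_sets[OF assms(2), of "{s}"] by (simp add: vimage_def Int_def conj_commute)
  have z: "AE \<omega> in M. ?g \<omega> * ?t \<omega> = 0"
    using assms(5,6) unfolding is_regression_def by (auto simp: indicator_def)
  have int: "integrable M (\<lambda>\<omega>. ?g \<omega> * ?t \<omega>)"
    by (intro integrable_const_bound[where B = 1]) (auto simp: indicator_def)
  have eq: "(\<integral>\<omega>. ?g \<omega> * ?p \<omega> \<partial>M) = (\<integral>\<omega>. ?g \<omega> * ?t \<omega> \<partial>M)"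
    and int': "integrable M (\<lambda>\<omega>. ?g \<omega> * ?p \<omega>)"
    unfolding cprob_def using real_cond_exp_intg[OF int] by auto
  have "(\<integral>\<omega>. ?g \<omega> * ?t \<omega> \<partial>M) = 0" using z by (simp cong: integral_cong_AE add: integral_eq_zero_AE)
  with eq have "(\<integral>\<omega>. ?g \<omega> * ?p \<omega> \<partial>M) = 0" by simp
  moreover have pos: "AE \<omega> in M. ?p \<omega> > 0" using assms(4) by (simp add: overlap_def)
  ultimately have "AE \<omega> in M. ?g \<omega> * ?p \<omega> = 0"
    using int' by (subst (asm) integral_nonneg_eq_0_iff_AE) (auto elim!: eventually_mono simp: indicator_def)
  with pos show ?thesis
    using AE_space
  proof eventually_elim
    case (elim \<omega>)
    have "C \<omega> \<in> space E" using elim(3) by (rule measurable_space[OF assms(3)])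
    with elim(1,2) show ?case by (auto simp: indicator_def split: if_splits)
  qed
qed


section \<open>Exposure contrasts\<close>

text \<open>\<open>override_on d (\<delta> i) (nbhd A i K)\<close> is the assignment that agrees with \<open>\<delta> i\<close> on the
  \<open>K\<close>-neighborhood of \<open>i\<close> and with \<open>d\<close> off it; the values of \<open>\<delta> i\<close> off the neighborhood
  are never used.\<close>

definition exposure :: "('n \<Rightarrow> ('n \<Rightarrow> bool) \<Rightarrow> 'e) \<Rightarrow> ('w \<Rightarrow> 'n \<Rightarrow> bool) \<Rightarrow> 'n \<Rightarrow> 'w \<Rightarrow> 'e" where
  "exposure f D i \<omega> = f i (D \<omega>)"

definition observed :: "('n \<Rightarrow> 'w \<Rightarrow> ('n \<Rightarrow> bool) \<Rightarrow> real) \<Rightarrow> ('w \<Rightarrow> 'n \<Rightarrow> bool) \<Rightarrow>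
    'n \<Rightarrow> 'w \<Rightarrow> real" where
  "observed Y D i \<omega> = Y i \<omega> (D \<omega>)"

definition baseline :: "bool ^ 'n ^ 'n \<Rightarrow> nat \<Rightarrow> ('n \<Rightarrow> 'n \<Rightarrow> bool) \<Rightarrow>
    ('n \<Rightarrow> 'w \<Rightarrow> ('n \<Rightarrow> bool) \<Rightarrow> real) \<Rightarrow> ('w \<Rightarrow> 'n \<Rightarrow> bool) \<Rightarrow> 'n \<Rightarrow> 'w \<Rightarrow> real" where
  "baseline A K \<delta> Y D i \<omega> = Y i \<omega> (override_on (D \<omega>) (\<delta> i) (nbhd A i K))"

definition exposure_contrast :: "'w measure \<Rightarrow> ('n::finite \<Rightarrow> ('n \<Rightarrow> bool) \<Rightarrow> real ^ 'k) \<Rightarrow>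
    ('n \<Rightarrow> 'w \<Rightarrow> ('n \<Rightarrow> bool) \<Rightarrow> real) \<Rightarrow> ('w \<Rightarrow> 'n \<Rightarrow> bool) \<Rightarrow>
    ('n \<Rightarrow> 'c measure) \<Rightarrow> ('n \<Rightarrow> 'w \<Rightarrow> 'c) \<Rightarrow> real ^ 'k \<Rightarrow> real ^ 'k \<Rightarrow> 'w \<Rightarrow> real" where
  "exposure_contrast M f Y D E C t t' \<omega> =
     (1 / real CARD('n)) * (\<Sum>i\<in>UNIV.
        cmean M (observed Y D i) (exposure f D i) (E i) (C i) t \<omega>
      - cmean M (observed Y D i) (exposure f D i) (E i) (C i) t' \<omega>)"

definition tau_star :: "'w measure \<Rightarrow> bool ^ 'n ^ 'n \<Rightarrow> nat \<Rightarrow> ('n \<Rightarrow> 'n \<Rightarrow> bool) \<Rightarrow>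
    ('n::finite \<Rightarrow> ('n \<Rightarrow> bool) \<Rightarrow> real ^ 'k) \<Rightarrow>
    ('n \<Rightarrow> 'w \<Rightarrow> ('n \<Rightarrow> bool) \<Rightarrow> real) \<Rightarrow> ('w \<Rightarrow> 'n \<Rightarrow> bool) \<Rightarrow>
    ('n \<Rightarrow> 'c measure) \<Rightarrow> ('n \<Rightarrow> 'w \<Rightarrow> 'c) \<Rightarrow> real ^ 'k \<Rightarrow> 'w \<Rightarrow> real" where
  "tau_star M A K \<delta> f Y D E C t \<omega> =
     (1 / real CARD('n)) * (\<Sum>i\<in>UNIV.
        cmean M (\<lambda>\<omega>. observed Y D i \<omega> - baseline A K \<delta> Y D i \<omega>)
          (exposure f D i) (E i) (C i) t \<omega>)"

definition bias :: "'w measure \<Rightarrow> bool ^ 'n ^ 'n \<Rightarrow> nat \<Rightarrow> ('n \<Rightarrow> 'n \<Rightarrow> bool) \<Rightarrow>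
    ('n::finite \<Rightarrow> ('n \<Rightarrow> bool) \<Rightarrow> real ^ 'k) \<Rightarrow>
    ('n \<Rightarrow> 'w \<Rightarrow> ('n \<Rightarrow> bool) \<Rightarrow> real) \<Rightarrow> ('w \<Rightarrow> 'n \<Rightarrow> bool) \<Rightarrow>
    ('n \<Rightarrow> 'c measure) \<Rightarrow> ('n \<Rightarrow> 'w \<Rightarrow> 'c) \<Rightarrow> real ^ 'k \<Rightarrow> real ^ 'k \<Rightarrow> 'w \<Rightarrow> real" where
  "bias M A K \<delta> f Y D E C t t' \<omega> =
     (1 / real CARD('n)) * (\<Sum>i\<in>UNIV.
        cmean M (baseline A K \<delta> Y D i) (exposure f D i) (E i) (C i) t \<omega>
      - cmean M (baseline A K \<delta> Y D i) (exposure f D i) (E i) (C i) t' \<omega>)"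

end

theory Submission
  imports Defs
begin

text \<open>For any integrable \<open>Z\<close>, \<open>E[Z | T = s, C] P(T = s | C) = E[Z 1\<^bsub>T = s\<^esub> | C]\<close>, so under overlap
  every exposure-conditional mean is a quotient of conditional expectations given \<open>C\<close> alone.
  Linearity in \<open>Z\<close> follows, and since degeneracy makes \<open>Y\<^sub>i\<close> and its baseline agree on
  \<open>{T\<^sub>i = t'}\<close>, the decomposition does too. For the bias, split the baseline according to the
  value \<open>v\<close> of the assignment outside the neighborhood: on each piece it is a potential outcome at a fixed
  assignment, which unconfoundedness separates from the assignment. Independence of the
  assignments inside and outside then gives
  \<open>E[baseline 1\<^bsub>T = s\<^esub> | C] = P(T = s | C) E[baseline | C]\<close>, so the mean of the baseline does
  not depend on \<open>s\<close>.\<close>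

section \<open>Sigma-algebras generated by a random variable\<close>

lemma measurable_gen_sigma:
  assumes "X \<in> measurable M S"
  shows "X \<in> measurable (gen_sigma M S X) S"
  unfolding gen_sigma_def using measurable_space[OF assms]
  by (intro measurable_vimage_algebra1) auto

text \<open>\<open>N\<close> is kept apart from \<open>M\<close> so that it can also be the
  sigma-algebra generated by \<open>(T, C)\<close>; this yields the nesting of the one generated by
  \<open>C\<close> inside it, on which the tower property relies.\<close>

lemma subalgebra_gen_sigma:
  assumes "space N = space M" "X \<in> measurable N S"
  shows "subalgebra N (gen_sigma M S X)"
  using measurable_space[OF assms(2)] measurable_sets[OF assms(2)] assms(1)
  by (auto simp: gen_sigma_def subalgebra_def sets_vimage_algebra2[of X "space M" S])

lemma finite_measure_subalgebra_gen_sigma: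
  assumes "prob_space M" "X \<in> measurable M S"
  shows "finite_measure_subalgebra M (gen_sigma M S X)"
  using assms by (auto simp: finite_measure_subalgebra_def finite_measure_subalgebra_axioms_def
      prob_space_def intro!: subalgebra_gen_sigma)

section \<open>Means at a fixed exposure value through conditioning on \<open>C\<close>
  alone\<close>

text \<open>On \<open>{T = s}\<close> the regression \<open>m (T, C)\<close> equals
  \<open>m (s, C)\<close>, which depends on \<open>C\<close> only. Conditioning first on
  \<open>(T, C)\<close> and then on \<open>C\<close>, this factor can be pulled out, and what
  remains is the conditional probability of \<open>{T = s}\<close>.\<close>

lemma cmean_mult_cprob:
  fixes s :: "'e::t1_space"
  assumes "prob_space M" "T \<in> borel_measurable M" "C \<in> measurable M E" "integrable M Z"
  shows "AE \<omega> in M. cmean M Z T E C s \<omega> * cprob M E C (\<lambda>\<omega>. T \<omega> = s) \<omega> =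
    real_cond_exp M (gen_sigma M E C) (\<lambda>\<omega>. Z \<omega> * indicator {\<omega> \<in> space M. T \<omega> = s} \<omega>) \<omega>"
proof -
  interpret prob_space M by fact
  note [measurable] = assms(2,3)
  define m where "m = (SOME m. is_regression M Z T E C m)"
  have m: "is_regression M Z T E C m"
    unfolding m_def using is_regression_exists[OF assms(2,3)] by (rule someI_ex)
  then have [measurable]: "m \<in> borel_measurable (borel \<Otimes>\<^sub>M E)" by (simp add: is_regression_def)
  let ?F = "gen_sigma M E C" and ?S = "borel \<Otimes>\<^sub>M E" and ?X = "\<lambda>\<omega>. (T \<omega>, C \<omega>)"
  let ?G = "gen_sigma M ?S ?X"
  let ?B = "{\<omega> \<in> space M. T \<omega> = s}"
  have X: "?X \<in> measurable M ?S" by measurable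
  interpret F: finite_measure_subalgebra M ?F
    by (rule finite_measure_subalgebra_gen_sigma) fact+
  interpret G: finite_measure_subalgebra M ?G
    by (rule finite_measure_subalgebra_gen_sigma) fact+
  have [measurable]: "?X \<in> measurable ?G ?S" by (rule measurable_gen_sigma[OF X])
  have TG [measurable]: "T \<in> borel_measurable ?G" and CG: "C \<in> measurable ?G E"
    using measurable_fst'[of ?X ?G borel E] measurable_snd'[of ?X ?G borel E] by simp_all
  have spG: "space ?G = space M" by (simp add: gen_sigma_def)
  have GF: "subalgebra ?G ?F"
    using subalgebra_gen_sigma[OF spG CG] .
  \<comment> \<open>Singletons are closed in a T1 space, so \<open>{T = s}\<close> is an event of
    the sigma-algebra of \<open>(T, C)\<close> and its indicator can be pulled out of
    \<open>real_cond_exp M ?G\<close>.\<close>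
  have sing: "{s} \<in> sets borel" by simp
  have BG: "?B \<in> sets ?G"
    using measurable_sets[OF TG sing] spG by (simp add: vimage_def Int_def conj_commute)
  then have BM: "?B \<in> sets M" using G.subalg by (auto simp: subalgebra_def)
  note [measurable] = BG BM
  have CF [measurable]: "C \<in> measurable ?F E" by (rule measurable_gen_sigma) fact
  have mE [measurable]: "(\<lambda>c. m (s, c)) \<in> borel_measurable E" by measurable
  have mF [measurable]: "(\<lambda>\<omega>. m (s, C \<omega>)) \<in> borel_measurable ?F" by measurable
  have mM [measurable]: "(\<lambda>\<omega>. m (s, C \<omega>)) \<in> borel_measurable M" by measurable
  have Zm [measurable]: "Z \<in> borel_measurable M" using assms(4) by simp
  have int: "integrable M (\<lambda>\<omega>. indicator ?B \<omega> * Z \<omega>)"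
    using integrable_mult_indicator[OF BM assms(4)] by simp
  have "AE \<omega> in M. real_cond_exp M ?G (\<lambda>\<omega>. indicator ?B \<omega> * Z \<omega>) \<omega>
      = indicator ?B \<omega> * real_cond_exp M ?G Z \<omega>"
    using int by (intro G.real_cond_exp_mult) auto
  moreover have "AE \<omega> in M. real_cond_exp M ?G Z \<omega> = m (T \<omega>, C \<omega>)"
    using m by (simp add: is_regression_def)
  ultimately have eq: "AE \<omega> in M. real_cond_exp M ?G (\<lambda>\<omega>. indicator ?B \<omega> * Z \<omega>) \<omega>
      = m (s, C \<omega>) * indicator ?B \<omega>"
    by eventually_elim (auto simp: indicator_def)
  \<comment> \<open>A regression version is only known to be measurable; integrability of
    \<open>m (s, C)\<close> on \<open>{T = s}\<close> is inherited from the conditional expectation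
    that it equals there.\<close>
  have "integrable M (real_cond_exp M ?G (\<lambda>\<omega>. indicator ?B \<omega> * Z \<omega>))"
    using int by (rule G.real_cond_exp_int(1))
  then have int': "integrable M (\<lambda>\<omega>. m (s, C \<omega>) * indicator ?B \<omega>)"
    by (rule integrable_cong_AE_imp) (use eq in \<open>auto elim: eventually_mono\<close>)
  have "AE \<omega> in M. real_cond_exp M ?F (\<lambda>\<omega>. indicator ?B \<omega> * Z \<omega>) \<omega>
      = real_cond_exp M ?F (real_cond_exp M ?G (\<lambda>\<omega>. indicator ?B \<omega> * Z \<omega>)) \<omega>"
    using F.real_cond_exp_nested_subalg[OF G.subalg GF int] by (auto elim: eventually_mono)
  moreover have "AE \<omega> in M. real_cond_exp M ?F (real_cond_exp M ?G (\<lambda>\<omega>. indicator ?B \<omega> * Z \<omega>)) \<omega>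
      = real_cond_exp M ?F (\<lambda>\<omega>. m (s, C \<omega>) * indicator ?B \<omega>) \<omega>"
    by (rule F.real_cond_exp_cong[OF eq]) measurable
  moreover have "AE \<omega> in M. real_cond_exp M ?F (\<lambda>\<omega>. m (s, C \<omega>) * indicator ?B \<omega>) \<omega>
      = m (s, C \<omega>) * cprob M E C (\<lambda>\<omega>. T \<omega> = s) \<omega>"
    unfolding cprob_def using int' by (intro F.real_cond_exp_mult) measurable
  ultimately show ?thesis
    unfolding cmean_def m_def[symmetric] by eventually_elim (simp add: mult.commute)
qed

section \<open>Conditional independence and conditional expectations\<close>

text \<open>Conditional independence passes to integrands \<open>W\<close> that are not integrable themselves; this is
  needed because a potential outcome \<open>Y\<^sub>i(d)\<close> at a fixed \<open>d\<close> need not be integrable. The cross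
  multiplication avoids dividing by conditional probabilities that may vanish. For an event \<open>G\<close>
  depending on \<open>C\<close>, the two measures \<open>E[1\<^sub>G 1\<^sub>P P(Q | C) ; W \<in> \<cdot>]\<close> and
  \<open>E[1\<^sub>G 1\<^sub>Q P(P | C) ; W \<in> \<cdot>]\<close> coincide, hence so do their first moments.\<close>

lemma cond_indep_cross_mult:
  fixes W :: "'w \<Rightarrow> real"
  assumes "prob_space M" and ind: "cond_indep M borel W R Z E C"
    and P: "P \<in> sets R" and Q: "Q \<in> sets R"
    and intP: "integrable M (\<lambda>\<omega>. W \<omega> * indicator {\<omega> \<in> space M. Z \<omega> \<in> P} \<omega>)"
    and intQ: "integrable M (\<lambda>\<omega>. W \<omega> * indicator {\<omega> \<in> space M. Z \<omega> \<in> Q} \<omega>)"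
  shows "AE \<omega> in M.
    real_cond_exp M (gen_sigma M E C) (\<lambda>\<omega>. W \<omega> * indicator {\<omega> \<in> space M. Z \<omega> \<in> P} \<omega>) \<omega>
      * cprob M E C (\<lambda>\<omega>. Z \<omega> \<in> Q) \<omega> =
    real_cond_exp M (gen_sigma M E C) (\<lambda>\<omega>. W \<omega> * indicator {\<omega> \<in> space M. Z \<omega> \<in> Q} \<omega>) \<omega>
      * cprob M E C (\<lambda>\<omega>. Z \<omega> \<in> P) \<omega>"
proof -
  interpret prob_space M by fact
  have W [measurable]: "W \<in> borel_measurable M" and Z [measurable]: "Z \<in> measurable M R"
    and C [measurable]: "C \<in> measurable M E"
    using ind by (auto simp: cond_indep_def)
  let ?F = "gen_sigma M E C"
  interpret F: finite_measure_subalgebra M ?F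
    by (rule finite_measure_subalgebra_gen_sigma) fact+
  let ?I = "\<lambda>P. indicator {\<omega> \<in> space M. Z \<omega> \<in> P} :: 'w \<Rightarrow> real"
  let ?p = "\<lambda>P. cprob M E C (\<lambda>\<omega>. Z \<omega> \<in> P)"
  have ev [measurable]: "{\<omega> \<in> space M. Z \<omega> \<in> P} \<in> sets M" if "P \<in> sets R" for P
    using measurable_sets[OF Z that] by (simp add: vimage_def Int_def conj_commute)
  have evW [measurable]: "{\<omega> \<in> space M. W \<omega> \<in> a} \<in> sets M" if "a \<in> sets borel" for a
    using measurable_sets[OF W that] by (simp add: vimage_def Int_def conj_commute)
  have pF [measurable]: "?p P \<in> borel_measurable ?F" for P
    by (simp add: cprob_def)
  have pM [measurable]: "?p P \<in> borel_measurable M" for P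
    by (simp add: cprob_def)
  have p_bounds: "AE \<omega> in M. 0 \<le> ?p P \<omega> \<and> ?p P \<omega> \<le> 1" if "P \<in> sets R" for P
  proof -
    have "integrable M (?I P)"
      using ev[OF that] by (simp add: integrable_indicator_iff less_top[symmetric])
    then have "AE \<omega> in M. ?p P \<omega> \<ge> 0" "AE \<omega> in M. ?p P \<omega> \<le> 1"
      unfolding cprob_def
      by (intro F.real_cond_exp_ge_c F.real_cond_exp_le_c; simp add: indicator_def)+
    then show ?thesis by eventually_elim simp
  qed
  \<comment> \<open>A conditional probability lies in [0, 1] almost everywhere, so the product is
    dominated by the integrable \<open>W * ?I P\<close>.\<close>
  have int_mult: "integrable M (\<lambda>\<omega>. ?p Q \<omega> * (W \<omega> * ?I P \<omega>))"
    if "P \<in> sets R" "Q \<in> sets R" "integrable M (\<lambda>\<omega>. W \<omega> * ?I P \<omega>)" for P Q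
  proof (rule Bochner_Integration.integrable_bound[OF that(3)])
    show "(\<lambda>\<omega>. ?p Q \<omega> * (W \<omega> * ?I P \<omega>)) \<in> borel_measurable M"
      using ev[OF that(1)] by measurable
    show "AE \<omega> in M. norm (?p Q \<omega> * (W \<omega> * ?I P \<omega>)) \<le> norm (W \<omega> * ?I P \<omega>)"
      using p_bounds[OF that(2)] by eventually_elim (simp add: abs_mult mult_left_le_one_le)
  qed
  \<comment> \<open>\<open>N A P Q\<close> is the law of \<open>W\<close> under \<open>M\<close>
    reweighted by the bounded density \<open>dens A P Q\<close>; its first moment is the integral to
    be compared.\<close>
  define dens where "dens = (\<lambda>A P Q \<omega>. indicator A \<omega> * ?p Q \<omega> * ?I P \<omega> :: real)"
  define N where "N = (\<lambda>A P Q. distr (density M (\<lambda>\<omega>. ennreal (dens A P Q \<omega>))) borel W)"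
  have dens_meas [measurable]: "dens A P Q \<in> borel_measurable M"
    if [measurable]: "A \<in> sets M" and "P \<in> sets R" for A P Q
    using ev[OF that(2)] unfolding dens_def by measurable
  have dens_nonneg: "AE \<omega> in M. 0 \<le> dens A P Q \<omega>" if "Q \<in> sets R" for A P Q
    using p_bounds[OF that] by eventually_elim (simp add: dens_def)
  \<comment> \<open>The factors \<open>indicator A\<close> and \<open>?p Q\<close> are functions of
    \<open>C\<close>, so the event \<open>{W \<in> a, Z \<in> P}\<close> may be replaced by its
    conditional probability, which factors. The result is symmetric in \<open>P\<close> and
    \<open>Q\<close>.\<close>
  have N_eq: "emeasure (N A P Q) a =
      ennreal (\<integral>\<omega>. indicator A \<omega> * ?p Q \<omega> * (cprob M E C (\<lambda>\<omega>. W \<omega> \<in> a) \<omega> * ?p P \<omega>) \<partial>M)"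
    if A: "A \<in> sets ?F" and P: "P \<in> sets R" and Q: "Q \<in> sets R" and a: "a \<in> sets borel" for A P Q a
  proof -
    have AM [measurable]: "A \<in> sets M" using A F.subalg by (auto simp: subalgebra_def)
    note [measurable] = A ev[OF P] evW[OF a]
    have int: "integrable M (\<lambda>\<omega>. (indicator A \<omega> * ?p Q \<omega>) *
        indicator {\<omega> \<in> space M. W \<omega> \<in> a \<and> Z \<omega> \<in> P} \<omega>)"
    proof (rule integrable_const_bound[where B = 1])
      show "AE \<omega> in M. norm ((indicator A \<omega> * ?p Q \<omega>) *
          indicator {\<omega> \<in> space M. W \<omega> \<in> a \<and> Z \<omega> \<in> P} \<omega> :: real) \<le> 1"
        using p_bounds[OF Q] by eventually_elim (auto simp: indicator_def)
    qed (use P a in measurable)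
    have "emeasure (N A P Q) a
        = (\<integral>\<^sup>+\<omega>. ennreal (dens A P Q \<omega>) * indicator (W -` a \<inter> space M) \<omega> \<partial>M)"
      using a P AM dens_meas[OF AM P]
      by (simp add: N_def emeasure_distr emeasure_density measurable_sets[OF W])
    also have "\<dots> = (\<integral>\<^sup>+\<omega>. ennreal ((indicator A \<omega> * ?p Q \<omega>) *
        indicator {\<omega> \<in> space M. W \<omega> \<in> a \<and> Z \<omega> \<in> P} \<omega>) \<partial>M)"
      by (intro nn_integral_cong) (auto simp: dens_def indicator_def)
    also have "\<dots> = ennreal (\<integral>\<omega>. (indicator A \<omega> * ?p Q \<omega>) *
        indicator {\<omega> \<in> space M. W \<omega> \<in> a \<and> Z \<omega> \<in> P} \<omega> \<partial>M)"
      using int p_bounds[OF Q] by (intro nn_integral_eq_integral) (auto elim: eventually_mono)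
    also have "(\<integral>\<omega>. (indicator A \<omega> * ?p Q \<omega>) *
        indicator {\<omega> \<in> space M. W \<omega> \<in> a \<and> Z \<omega> \<in> P} \<omega> \<partial>M)
      = (\<integral>\<omega>. (indicator A \<omega> * ?p Q \<omega>) * cprob M E C (\<lambda>\<omega>. W \<omega> \<in> a \<and> Z \<omega> \<in> P) \<omega> \<partial>M)"
      unfolding cprob_def[of M E C "\<lambda>\<omega>. W \<omega> \<in> a \<and> Z \<omega> \<in> P"]
      by (intro F.real_cond_exp_intg(2)[symmetric] int) (use P a in measurable)
    also have "\<dots> = (\<integral>\<omega>. indicator A \<omega> * ?p Q \<omega> * (cprob M E C (\<lambda>\<omega>. W \<omega> \<in> a) \<omega> * ?p P \<omega>) \<partial>M)"
    proof (rule integral_cong_AE)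
      have "AE \<omega> in M. cprob M E C (\<lambda>\<omega>. W \<omega> \<in> a \<and> Z \<omega> \<in> P) \<omega>
          = cprob M E C (\<lambda>\<omega>. W \<omega> \<in> a) \<omega> * ?p P \<omega>"
        using ind P a by (auto simp: cond_indep_def)
      then show "AE \<omega> in M. (indicator A \<omega> * ?p Q \<omega>) * cprob M E C (\<lambda>\<omega>. W \<omega> \<in> a \<and> Z \<omega> \<in> P) \<omega>
          = indicator A \<omega> * ?p Q \<omega> * (cprob M E C (\<lambda>\<omega>. W \<omega> \<in> a) \<omega> * ?p P \<omega>)"
        by eventually_elim simp
    qed (simp_all add: cprob_def)
    finally show ?thesis .
  qed
  have first_moment: "(\<integral>x. x \<partial>N A P Q) = (\<integral>\<omega>\<in>A. ?p Q \<omega> * (W \<omega> * ?I P \<omega>) \<partial>M)"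
    if A: "A \<in> sets ?F" and P: "P \<in> sets R" and Q: "Q \<in> sets R" for A P Q
  proof -
    have AM: "A \<in> sets M" using A F.subalg by (auto simp: subalgebra_def)
    have "(\<integral>x. x \<partial>N A P Q) = (\<integral>\<omega>. W \<omega> \<partial>density M (\<lambda>\<omega>. ennreal (dens A P Q \<omega>)))"
      unfolding N_def by (subst integral_distr) simp_all
    also have "\<dots> = (\<integral>\<omega>. dens A P Q \<omega> *\<^sub>R W \<omega> \<partial>M)"
      using dens_meas[OF AM P] dens_nonneg[OF Q] by (intro integral_density) auto
    finally show ?thesis
      by (simp add: dens_def set_lebesgue_integral_def mult_ac)
  qed
  have "(\<integral>\<omega>\<in>A. ?p Q \<omega> * (W \<omega> * ?I P \<omega>) \<partial>M) = (\<integral>\<omega>\<in>A. ?p P \<omega> * (W \<omega> * ?I Q \<omega>) \<partial>M)"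
    if A: "A \<in> sets ?F" for A
  proof -
    have "N A P Q = N A Q P"
    proof (rule measure_eqI)
      fix a assume "a \<in> sets (N A P Q)"
      then have "a \<in> sets borel" by (simp add: N_def)
      then show "emeasure (N A P Q) a = emeasure (N A Q P) a"
        using A P Q by (simp add: N_eq mult_ac)
    qed (simp add: N_def)
    then show ?thesis using first_moment[OF A P Q] first_moment[OF A Q P] by simp
  qed
  \<comment> \<open>Replacing the right integrand by its conditional expectation gives the form in
    which set integrals characterize \<open>real_cond_exp\<close>.\<close>
  then have set_eq: "(\<integral>\<omega>\<in>A. ?p Q \<omega> * (W \<omega> * ?I P \<omega>) \<partial>M) =
      (\<integral>\<omega>\<in>A. real_cond_exp M ?F (\<lambda>\<omega>. ?p P \<omega> * (W \<omega> * ?I Q \<omega>)) \<omega> \<partial>M)"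
    if "A \<in> sets ?F" for A
    using F.real_cond_exp_intA[OF int_mult[OF Q P intQ] that] that by simp
  have "AE \<omega> in M. real_cond_exp M ?F (\<lambda>\<omega>. ?p Q \<omega> * (W \<omega> * ?I P \<omega>)) \<omega>
      = real_cond_exp M ?F (\<lambda>\<omega>. ?p P \<omega> * (W \<omega> * ?I Q \<omega>)) \<omega>"
    using set_eq int_mult[OF P Q intP] F.real_cond_exp_int(1)[OF int_mult[OF Q P intQ]]
    by (intro F.real_cond_exp_charact) auto
  moreover have "AE \<omega> in M. real_cond_exp M ?F (\<lambda>\<omega>. ?p Q \<omega> * (W \<omega> * ?I P \<omega>)) \<omega>
      = ?p Q \<omega> * real_cond_exp M ?F (\<lambda>\<omega>. W \<omega> * ?I P \<omega>) \<omega>"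
    using int_mult[OF P Q intP] intP by (intro F.real_cond_exp_mult) auto
  moreover have "AE \<omega> in M. real_cond_exp M ?F (\<lambda>\<omega>. ?p P \<omega> * (W \<omega> * ?I Q \<omega>)) \<omega>
      = ?p P \<omega> * real_cond_exp M ?F (\<lambda>\<omega>. W \<omega> * ?I Q \<omega>) \<omega>"
    using int_mult[OF Q P intQ] intQ by (intro F.real_cond_exp_mult) auto
  ultimately show ?thesis by eventually_elim (simp add: mult.commute)
qed

lemma cond_indepD:
  assumes "cond_indep M S X R Z E C" "a \<in> sets S" "b \<in> sets R"
  shows "AE \<omega> in M. cprob M E C (\<lambda>\<omega>. X \<omega> \<in> a \<and> Z \<omega> \<in> b) \<omega> =
    cprob M E C (\<lambda>\<omega>. X \<omega> \<in> a) \<omega> * cprob M E C (\<lambda>\<omega>. Z \<omega> \<in> b) \<omega>"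
  using assms unfolding cond_indep_def by blast

text \<open>Events of \<open>g (X)\<close> and \<open>h (Z)\<close> are events of \<open>X\<close>
  and \<open>Z\<close>. This carries unconfoundedness from the whole random map of potential
  outcomes to its value at one fixed assignment.\<close>

lemma cond_indep_compose:
  assumes ind: "cond_indep M S X R Z E C" and g: "g \<in> measurable S S'" and h: "h \<in> measurable R R'"
  shows "cond_indep M S' (\<lambda>\<omega>. g (X \<omega>)) R' (\<lambda>\<omega>. h (Z \<omega>)) E C"
proof -
  have X: "X \<in> measurable M S" and Z: "Z \<in> measurable M R"
    using ind by (simp_all add: cond_indep_def)
  have "AE \<omega> in M. cprob M E C (\<lambda>\<omega>. g (X \<omega>) \<in> a \<and> h (Z \<omega>) \<in> b) \<omega> =
      cprob M E C (\<lambda>\<omega>. g (X \<omega>) \<in> a) \<omega> * cprob M E C (\<lambda>\<omega>. h (Z \<omega>) \<in> b) \<omega>"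
    if a: "a \<in> sets S'" and b: "b \<in> sets R'" for a b
  proof -
    let ?a = "g -` a \<inter> space S" and ?b = "h -` b \<inter> space R"
    have "cprob M E C (\<lambda>\<omega>. g (X \<omega>) \<in> a \<and> h (Z \<omega>) \<in> b) = cprob M E C (\<lambda>\<omega>. X \<omega> \<in> ?a \<and> Z \<omega> \<in> ?b)"
      "cprob M E C (\<lambda>\<omega>. g (X \<omega>) \<in> a) = cprob M E C (\<lambda>\<omega>. X \<omega> \<in> ?a)"
      "cprob M E C (\<lambda>\<omega>. h (Z \<omega>) \<in> b) = cprob M E C (\<lambda>\<omega>. Z \<omega> \<in> ?b)"
      using measurable_space[OF X] measurable_space[OF Z] unfolding cprob_def
      by (intro arg_cong2[where f = "real_cond_exp M"] arg_cong[where f = indicator]; auto)+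
    moreover have "AE \<omega> in M. cprob M E C (\<lambda>\<omega>. X \<omega> \<in> ?a \<and> Z \<omega> \<in> ?b) \<omega> =
        cprob M E C (\<lambda>\<omega>. X \<omega> \<in> ?a) \<omega> * cprob M E C (\<lambda>\<omega>. Z \<omega> \<in> ?b) \<omega>"
      by (rule cond_indepD[OF ind measurable_sets[OF g a] measurable_sets[OF h b]])
    ultimately show ?thesis by metis
  qed
  then show ?thesis
    using ind measurable_compose[OF X g] measurable_compose[OF Z h] unfolding cond_indep_def by blast
qed

text \<open>The event \<open>G\<close> that the conditional probability of \<open>P\<close> vanishes
  depends on \<open>C\<close>, so averaging that conditional probability over \<open>G\<close> shows
  that \<open>P\<close> and \<open>G\<close> meet in a null set. Hence the integrand vanishes almost
  everywhere on \<open>G\<close>, and so does its conditional expectation. This covers the points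
  where a conditional probability cannot be cancelled.\<close>

lemma real_cond_exp_eq_0_if_cprob_eq_0:
  assumes "prob_space M" "C \<in> measurable M E"
    and B [measurable]: "{\<omega> \<in> space M. P \<omega>} \<in> sets M"
    and int: "integrable M (\<lambda>\<omega>. W \<omega> * indicator {\<omega> \<in> space M. P \<omega>} \<omega>)"
  shows "AE \<omega> in M. cprob M E C P \<omega> = 0 \<longrightarrow>
    real_cond_exp M (gen_sigma M E C) (\<lambda>\<omega>. W \<omega> * indicator {\<omega> \<in> space M. P \<omega>} \<omega>) \<omega> = 0"
proof -
  interpret prob_space M by fact
  let ?F = "gen_sigma M E C"
  interpret F: finite_measure_subalgebra M ?F
    by (rule finite_measure_subalgebra_gen_sigma) fact+
  let ?I = "indicator {\<omega> \<in> space M. P \<omega>} :: _ \<Rightarrow> real"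
  let ?W = "\<lambda>\<omega>. W \<omega> * ?I \<omega>"
  define g :: "_ \<Rightarrow> real" where "g = (\<lambda>\<omega>. indicator {0} (cprob M E C P \<omega>))"
  have [measurable]: "g \<in> borel_measurable ?F" unfolding g_def cprob_def by measurable
  have [measurable]: "g \<in> borel_measurable M" unfolding g_def cprob_def by measurable
  have intI: "integrable M (\<lambda>\<omega>. g \<omega> * ?I \<omega>)"
  proof (rule integrable_const_bound[where B = 1])
    show "(\<lambda>\<omega>. g \<omega> * ?I \<omega>) \<in> borel_measurable M" by measurable
  qed (auto simp: indicator_def g_def)
  have "(\<integral>\<omega>. g \<omega> * ?I \<omega> \<partial>M) = (\<integral>\<omega>. g \<omega> * cprob M E C P \<omega> \<partial>M)"
    unfolding cprob_def by (rule F.real_cond_exp_intg(2)[symmetric, OF intI]) measurable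
  also have "\<dots> = 0" by (intro integral_eq_zero_AE) (auto simp: g_def indicator_def)
  finally have "AE \<omega> in M. g \<omega> * ?I \<omega> = 0"
    using intI by (subst (asm) integral_nonneg_eq_0_iff_AE) (auto simp: g_def)
  then have zero: "AE \<omega> in M. g \<omega> * ?W \<omega> = 0" by eventually_elim auto
  have W [measurable]: "?W \<in> borel_measurable M" using int by simp
  have gW: "integrable M (\<lambda>\<omega>. g \<omega> * ?W \<omega>)"
    by (rule integrable_cong_AE_imp[of _ "\<lambda>_. 0"]) (use zero in \<open>auto elim: eventually_mono\<close>)
  have "AE \<omega> in M. real_cond_exp M ?F (\<lambda>\<omega>. g \<omega> * ?W \<omega>) \<omega> = g \<omega> * real_cond_exp M ?F ?W \<omega>"
    using gW by (intro F.real_cond_exp_mult) measurable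
  moreover have "AE \<omega> in M. real_cond_exp M ?F (\<lambda>\<omega>. g \<omega> * ?W \<omega>) \<omega> = real_cond_exp M ?F (\<lambda>_. 0) \<omega>"
    using zero by (rule F.real_cond_exp_cong) measurable
  moreover have "AE \<omega> in M. real_cond_exp M ?F (\<lambda>_. 0) \<omega> = 0"
    by (rule F.real_cond_exp_F_meas) auto
  ultimately show ?thesis by eventually_elim (auto simp: g_def)
qed

text \<open>On \<open>{V = v}\<close> the integrand is \<open>W v\<close>, which is conditionally
  independent of \<open>(U, V)\<close>. Comparing the events \<open>S \<times> {v}\<close> and
  \<open>UNIV \<times> {v}\<close> and factoring the probability of the former yields the claim on
  each piece; finiteness of the type of \<open>v\<close> allows summation.\<close>

lemma real_cond_exp_mult_indicator_cond_indep:
  fixes W :: "'v::finite \<Rightarrow> 'w \<Rightarrow> real"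
  assumes "prob_space M"
    and UV: "cond_indep M (count_space UNIV) U (count_space UNIV) V E C"
    and W: "\<And>v. cond_indep M borel (W v) (count_space UNIV) (\<lambda>\<omega>. (U \<omega>, V \<omega>)) E C"
    and int: "integrable M (\<lambda>\<omega>. W (V \<omega>) \<omega>)"
  shows "AE \<omega> in M.
    real_cond_exp M (gen_sigma M E C) (\<lambda>\<omega>. W (V \<omega>) \<omega> * indicator {\<omega> \<in> space M. U \<omega> \<in> S} \<omega>) \<omega> =
    cprob M E C (\<lambda>\<omega>. U \<omega> \<in> S) \<omega> * real_cond_exp M (gen_sigma M E C) (\<lambda>\<omega>. W (V \<omega>) \<omega>) \<omega>"
proof -
  interpret prob_space M by fact
  let ?F = "gen_sigma M E C"
  have C: "C \<in> measurable M E" using UV by (simp add: cond_indep_def)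
  interpret F: finite_measure_subalgebra M ?F
    by (rule finite_measure_subalgebra_gen_sigma) fact+
  have meas: "(\<lambda>\<omega>. (U \<omega>, V \<omega>)) \<in> measurable M (count_space UNIV)"
    using W by (auto simp: cond_indep_def)
  have ev: "{\<omega> \<in> space M. (U \<omega>, V \<omega>) \<in> B} \<in> sets M" for B
    using measurable_sets[OF meas, of B] by (simp add: vimage_def Int_def conj_commute)
  let ?I = "\<lambda>B. indicator {\<omega> \<in> space M. (U \<omega>, V \<omega>) \<in> B} :: 'w \<Rightarrow> real"
  let ?p = "cprob M E C (\<lambda>\<omega>. U \<omega> \<in> S)" and ?q = "\<lambda>v. cprob M E C (\<lambda>\<omega>. V \<omega> \<in> {v})"
  let ?r = "\<lambda>T v. real_cond_exp M ?F (\<lambda>\<omega>. W v \<omega> * ?I (T \<times> {v}) \<omega>)"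
  \<comment> \<open>\<open>W v\<close> alone may fail to be integrable, but on
    \<open>{V = v}\<close> it agrees with the integrable
    \<open>W (V \<omega>) \<omega>\<close>.\<close>
  have intB: "integrable M (\<lambda>\<omega>. W v \<omega> * ?I (T \<times> {v}) \<omega>)" for T v
  proof -
    have "integrable M (\<lambda>\<omega>. ?I (T \<times> {v}) \<omega> *\<^sub>R W (V \<omega>) \<omega>)"
      by (rule integrable_mult_indicator[OF ev int])
    then show ?thesis
      by (rule Bochner_Integration.integrable_cong[THEN iffD1, rotated -1])
        (auto simp: indicator_def)
  qed
  have sum: "AE \<omega> in M. real_cond_exp M ?F (\<lambda>\<omega>. W (V \<omega>) \<omega> * indicator {\<omega> \<in> space M. U \<omega> \<in> T} \<omega>) \<omega>
      = (\<Sum>v\<in>UNIV. ?r T v \<omega>)" for T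
  proof -
    have split: "W (V \<omega>) \<omega> * indicator {\<omega> \<in> space M. U \<omega> \<in> T} \<omega>
        = (\<Sum>v\<in>UNIV. W v \<omega> * ?I (T \<times> {v}) \<omega>)" for \<omega>
    proof -
      have "(\<Sum>v\<in>UNIV. W v \<omega> * ?I (T \<times> {v}) \<omega>)
          = (\<Sum>v\<in>UNIV. if v = V \<omega> then W v \<omega> * indicator {\<omega> \<in> space M. U \<omega> \<in> T} \<omega> else 0)"
        by (intro sum.cong) (auto simp: indicator_def)
      then show ?thesis by simp
    qed
    show ?thesis unfolding split by (rule F.real_cond_exp_sum) (rule intB)
  qed
  have factor: "AE \<omega> in M. ?r S v \<omega> = ?p \<omega> * ?r UNIV v \<omega>" for v
  proof -
    have "AE \<omega> in M. ?r S v \<omega> * cprob M E C (\<lambda>\<omega>. (U \<omega>, V \<omega>) \<in> UNIV \<times> {v}) \<omega>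
        = ?r UNIV v \<omega> * cprob M E C (\<lambda>\<omega>. (U \<omega>, V \<omega>) \<in> S \<times> {v}) \<omega>"
      by (rule cond_indep_cross_mult[OF \<open>prob_space M\<close> W _ _ intB intB]) simp_all
    moreover have "AE \<omega> in M. cprob M E C (\<lambda>\<omega>. U \<omega> \<in> S \<and> V \<omega> \<in> {v}) \<omega> = ?p \<omega> * ?q v \<omega>"
      by (rule cond_indepD[OF UV]) simp_all
    \<comment> \<open>The common factor \<open>?q v\<close> cancels where it is positive; where it
      is zero, both sides of the claim are shown to be zero.\<close>
    moreover have "AE \<omega> in M. ?q v \<omega> = 0 \<longrightarrow> ?r UNIV v \<omega> = 0"
      using real_cond_exp_eq_0_if_cprob_eq_0[OF \<open>prob_space M\<close> C ev intB, of UNIV v] by simp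
    moreover have "AE \<omega> in M. ?q v \<omega> = 0 \<longrightarrow> ?r S v \<omega> = 0"
    proof -
      have "{\<omega> \<in> space M. V \<omega> \<in> {v}} \<in> sets M" using ev[of "UNIV \<times> {v}"] by simp
      \<comment> \<open>The extra indicator exposes \<open>{V = v}\<close> as the conditioning
        event, since the vanishing probability is that of \<open>{V = v}\<close> and not of the
        smaller event \<open>S \<times> {v}\<close>.\<close>
      moreover have restr: "W v \<omega> * ?I (S \<times> {v}) \<omega> =
          (W v \<omega> * ?I (S \<times> {v}) \<omega>) * indicator {\<omega> \<in> space M. V \<omega> \<in> {v}} \<omega>" for \<omega>
        by (auto simp: indicator_def)
      ultimately show ?thesis
        using intB[of v S]
          real_cond_exp_eq_0_if_cprob_eq_0[OF \<open>prob_space M\<close> C,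
            of "\<lambda>\<omega>. V \<omega> \<in> {v}" "\<lambda>\<omega>. W v \<omega> * ?I (S \<times> {v}) \<omega>"]
        by (simp only: restr[symmetric])
    qed
    ultimately show ?thesis
      by eventually_elim auto
  qed
  have "AE \<omega> in M. \<forall>v. ?r S v \<omega> = ?p \<omega> * ?r UNIV v \<omega>"
    using factor by (simp add: AE_all_countable)
  moreover have "AE \<omega> in M. real_cond_exp M ?F (\<lambda>\<omega>. W (V \<omega>) \<omega>) \<omega> = (\<Sum>v\<in>UNIV. ?r UNIV v \<omega>)"
  proof -
    have "AE \<omega> in M. real_cond_exp M ?F (\<lambda>\<omega>. W (V \<omega>) \<omega>) \<omega> =
        real_cond_exp M ?F (\<lambda>\<omega>. W (V \<omega>) \<omega> * indicator {\<omega> \<in> space M. U \<omega> \<in> UNIV} \<omega>) \<omega>"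
      using int by (intro F.real_cond_exp_cong) auto
    with sum[of UNIV] show ?thesis by eventually_elim simp
  qed
  ultimately show ?thesis
    using sum[of S] by eventually_elim (simp add: sum_distrib_left)
qed

section \<open>The decomposition of the contrast and the vanishing of the bias\<close>

theorem theorem3:
  fixes M :: "'w measure"
    and A :: "bool ^ 'n ^ 'n"
    and K :: nat
    and f :: "'n::finite \<Rightarrow> ('n \<Rightarrow> bool) \<Rightarrow> real ^ 'k"
    and D :: "'w \<Rightarrow> 'n \<Rightarrow> bool"
    and Y :: "'n \<Rightarrow> 'w \<Rightarrow> ('n \<Rightarrow> bool) \<Rightarrow> real"
    and E :: "'n \<Rightarrow> 'c measure"
    and C :: "'n \<Rightarrow> 'w \<Rightarrow> 'c"
    and \<delta> :: "'n \<Rightarrow> 'n \<Rightarrow> bool"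
    and t t' :: "real ^ 'k"
  assumes "prob_space M"
    and "D \<in> measurable M (count_space UNIV)"
    and "\<And>i. Y i \<in> measurable M (\<Pi>\<^sub>M d\<in>UNIV. borel)"
    and "\<And>i. C i \<in> measurable M (E i)"
    and "\<And>i. integrable M (observed Y D i)"
    and "\<And>i. integrable M (baseline A K \<delta> Y D i)"
    and exposure: "nbhd_exposure_mapping A K f"
    and overlap: "\<And>i s. s \<in> {t, t'} \<Longrightarrow> overlap M (exposure f D i) (E i) (C i) s"
    and unconfoundedness:
      "\<And>i. cond_indep M (\<Pi>\<^sub>M d\<in>UNIV. borel) (Y i) (count_space UNIV) D (E i) (C i)"
    and degeneracy:
      "\<And>i d. f i d = t' \<Longrightarrow>
         AE \<omega> in M. Y i \<omega> d = Y i \<omega> (override_on d (\<delta> i) (nbhd A i K))"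
  shows "(AE \<omega> in M. exposure_contrast M f Y D E C t t' \<omega> =
            tau_star M A K \<delta> f Y D E C t \<omega> + bias M A K \<delta> f Y D E C t t' \<omega>) \<and>
         ((\<forall>i. cond_indep M
              (count_space UNIV) (\<lambda>\<omega>. restrict (D \<omega>) (nbhd A i K))
              (count_space UNIV) (\<lambda>\<omega>. restrict (D \<omega>) (- nbhd A i K)) (E i) (C i)) \<longrightarrow>
          (AE \<omega> in M. bias M A K \<delta> f Y D E C t t' \<omega> = 0))"
proof -
  let ?N = "\<lambda>i. nbhd A i K"
  let ?O = "observed Y D" and ?B = "baseline A K \<delta> Y D" and ?T = "exposure f D"
  let ?m = "\<lambda>i Z s. cmean M Z (?T i) (E i) (C i) s"
  let ?p = "\<lambda>i s. cprob M (E i) (C i) (\<lambda>\<omega>. ?T i \<omega> = s)"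
  let ?I = "\<lambda>i s. indicator {\<omega> \<in> space M. ?T i \<omega> = s} :: 'w \<Rightarrow> real"
  let ?r = "\<lambda>i. real_cond_exp M (gen_sigma M (E i) (C i))"
  note int = assms(5,6)
  have T: "?T i \<in> borel_measurable M" for i
    unfolding exposure_def using assms(2) by (rule measurable_compose) simp
  have ev: "{\<omega> \<in> space M. ?T i \<omega> = s} \<in> sets M" for i s
    using measurable_sets[OF T, of "{s}" i] by (simp add: vimage_def Int_def conj_commute)
  note t_in = insertI1[of t "{t'}"] and t'_in = insertI2[OF singletonI[of t'], of t]
  have pos: "AE \<omega> in M. ?p i s \<omega> > 0" if "s \<in> {t, t'}" for i s
    using overlap[OF that] by (simp add: overlap_def)
  have key: "AE \<omega> in M. ?m i Z s \<omega> = ?r i (\<lambda>\<omega>. Z \<omega> * ?I i s \<omega>) \<omega> / ?p i s \<omega>"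
    if "integrable M Z" "s \<in> {t, t'}" for i Z s
    using cmean_mult_cprob[OF assms(1) T assms(4) that(1), of i i s] pos[OF that(2), of i]
    by eventually_elim (simp add: eq_divide_eq)
  have intI: "integrable M (\<lambda>\<omega>. Z \<omega> * ?I i s \<omega>)" if "integrable M Z" for i Z s
    using integrable_mult_indicator[OF ev that] by (simp add: mult.commute)
  have fin: "finite_measure_subalgebra M (gen_sigma M (E i) (C i))" for i
    by (rule finite_measure_subalgebra_gen_sigma[OF assms(1,4)])

  \<comment> \<open>The regression versions behind the three means are chosen independently of each
    other, so linearity is read off the quotients in \<open>key\<close>.\<close>
  have diff: "AE \<omega> in M. ?m i (\<lambda>\<omega>. ?O i \<omega> - ?B i \<omega>) t \<omega> = ?m i (?O i) t \<omega> - ?m i (?B i) t \<omega>" for i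
  proof -
    interpret F: finite_measure_subalgebra M "gen_sigma M (E i) (C i)" by (rule fin)
    have "AE \<omega> in M. ?r i (\<lambda>\<omega>. ?O i \<omega> * ?I i t \<omega> - ?B i \<omega> * ?I i t \<omega>) \<omega>
        = ?r i (\<lambda>\<omega>. ?O i \<omega> * ?I i t \<omega>) \<omega> - ?r i (\<lambda>\<omega>. ?B i \<omega> * ?I i t \<omega>) \<omega>"
      using intI int by (intro F.real_cond_exp_diff) auto
    with key[OF Bochner_Integration.integrable_diff[OF int(1)[of i] int(2)[of i]] t_in, of i]
      key[OF int(1)[of i] t_in, of i] key[OF int(2)[of i] t_in, of i]
    show ?thesis by eventually_elim (simp add: left_diff_distrib diff_divide_distrib)
  qed

  have degen: "AE \<omega> in M. ?m i (?O i) t' \<omega> = ?m i (?B i) t' \<omega>" for i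
  proof -
    interpret F: finite_measure_subalgebra M "gen_sigma M (E i) (C i)" by (rule fin)
    \<comment> \<open>There are finitely many assignments, so one null set serves all
      \<open>d\<close>, and the random assignment \<open>D \<omega>\<close> may be substituted for
      \<open>d\<close>.\<close>
    have "AE \<omega> in M. \<forall>d. f i d = t' \<longrightarrow> Y i \<omega> d = Y i \<omega> (override_on d (\<delta> i) (?N i))"
      using degeneracy by (auto simp: AE_all_countable)
    then have "AE \<omega> in M. ?O i \<omega> * ?I i t' \<omega> = ?B i \<omega> * ?I i t' \<omega>"
      by eventually_elim (auto simp: indicator_def exposure_def observed_def baseline_def)
    then have "AE \<omega> in M. ?r i (\<lambda>\<omega>. ?O i \<omega> * ?I i t' \<omega>) \<omega> = ?r i (\<lambda>\<omega>. ?B i \<omega> * ?I i t' \<omega>) \<omega>"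
      using intI int by (intro F.real_cond_exp_cong) auto
    with key[OF int(1)[of i] t'_in, of i] key[OF int(2)[of i] t'_in, of i]
    show ?thesis by eventually_elim simp
  qed

  have "AE \<omega> in M. exposure_contrast M f Y D E C t t' \<omega> =
      tau_star M A K \<delta> f Y D E C t \<omega> + bias M A K \<delta> f Y D E C t t' \<omega>"
  proof -
    have "AE \<omega> in M. \<forall>i. ?m i (\<lambda>\<omega>. ?O i \<omega> - ?B i \<omega>) t \<omega> = ?m i (?O i) t \<omega> - ?m i (?B i) t \<omega> \<and>
        ?m i (?O i) t' \<omega> = ?m i (?B i) t' \<omega>"
      using diff degen by (simp add: AE_all_countable)
    then show ?thesis
      unfolding exposure_contrast_def tau_star_def bias_def
      by eventually_elim (simp add: sum_subtractf diff_divide_distrib)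
  qed
  moreover have "AE \<omega> in M. bias M A K \<delta> f Y D E C t t' \<omega> = 0"
    if indep: "\<forall>i. cond_indep M
        (count_space UNIV) (\<lambda>\<omega>. restrict (D \<omega>) (?N i))
        (count_space UNIV) (\<lambda>\<omega>. restrict (D \<omega>) (- ?N i)) (E i) (C i)"
  proof -
    \<comment> \<open>The right-hand side does not contain \<open>s\<close>, so the means at
      \<open>t\<close> and \<open>t'\<close> agree.\<close>
    have baseline_mean: "AE \<omega> in M. ?m i (?B i) s \<omega> = ?r i (?B i) \<omega>"
      if "s \<in> {t, t'}" for i s
    proof -
      let ?U = "\<lambda>\<omega>. restrict (D \<omega>) (?N i)" and ?V = "\<lambda>\<omega>. restrict (D \<omega>) (- ?N i)"
      \<comment> \<open>\<open>?S\<close> collects the treatment patterns on the neighborhood that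
        produce exposure \<open>s\<close>; \<open>?W v\<close> is the potential outcome at the fixed
        assignment given by \<open>\<delta> i\<close> inside and \<open>v\<close> outside.\<close>
      let ?S = "(\<lambda>d. restrict d (?N i)) ` {d. f i d = s}"
      let ?W = "\<lambda>v \<omega>. Y i \<omega> (override_on v (\<delta> i) (?N i))"
      have "cond_indep M borel (?W v) (count_space UNIV) (\<lambda>\<omega>. (?U \<omega>, ?V \<omega>)) (E i) (C i)" for v
        using cond_indep_compose[OF unconfoundedness,
            of "\<lambda>y. y (override_on v (\<delta> i) (?N i))" borel
              "\<lambda>d. (restrict d (?N i), restrict d (- ?N i))" "count_space UNIV" i]
        by (simp add: measurable_component_singleton)
      moreover have B_eq: "?W (?V \<omega>) \<omega> = ?B i \<omega>" for \<omega>
        unfolding baseline_def by (rule arg_cong[where f = "Y i \<omega>"]) (auto simp: override_on_def)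
      ultimately have "AE \<omega> in M. ?r i (\<lambda>\<omega>. ?B i \<omega> * indicator {\<omega> \<in> space M. ?U \<omega> \<in> ?S} \<omega>) \<omega>
          = cprob M (E i) (C i) (\<lambda>\<omega>. ?U \<omega> \<in> ?S) \<omega> * ?r i (?B i) \<omega>"
        using real_cond_exp_mult_indicator_cond_indep[OF assms(1) spec[OF indep, of i],
            where W = ?W and S = ?S] int(2)
        by simp
      \<comment> \<open>This is where the exposure being determined by the neighborhood enters: it
        makes the event of exposure \<open>s\<close> an event about \<open>?U\<close> alone.\<close>
      moreover have T_eq: "?U \<omega> \<in> ?S \<longleftrightarrow> ?T i \<omega> = s" for \<omega>
      proof
        assume "?U \<omega> \<in> ?S"
        then obtain d where d: "f i d = s" "restrict (D \<omega>) (?N i) = restrict d (?N i)" by auto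
        then have "\<forall>j\<in>?N i. D \<omega> j = d j" by (metis restrict_apply')
        with exposure d(1) show "?T i \<omega> = s"
          by (auto simp: nbhd_exposure_mapping_def exposure_def)
      qed (auto simp: exposure_def)
      ultimately have "AE \<omega> in M. ?r i (\<lambda>\<omega>. ?B i \<omega> * ?I i s \<omega>) \<omega> = ?p i s \<omega> * ?r i (?B i) \<omega>"
        by simp
      with key[OF int(2)[of i] that, of i] pos[OF that, of i] show ?thesis by eventually_elim simp
    qed
    have "AE \<omega> in M. \<forall>i. ?m i (?B i) t \<omega> = ?m i (?B i) t' \<omega>"
      unfolding AE_all_countable
    proof
      show "AE \<omega> in M. ?m i (?B i) t \<omega> = ?m i (?B i) t' \<omega>" for i
        using baseline_mean[OF t_in, of i] baseline_mean[OF t'_in, of i] by eventually_elim simp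
    qed
    then show ?thesis unfolding bias_def by eventually_elim simp
  qed
  ultimately show ?thesis by blast
qed

end
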